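(* Let $\mathcal{H}$ be a complex Hilbert space, let $A\in\mathcal{B}(\mathcal{H})$ be a positive operator, and let $T\in\mathcal{B}_A(\mathcal{H})$. Then $$w_A^2(T)\le \min_{0\le\alpha\le 1}\left\|\alpha\, T^{\sharp_A}T+(1-\alpha)\,TT^{\sharp_A}\right\|_A .$$
   Context: $\mathcal{H}$ is a complex Hilbert space with inner product $\langle\cdot,\cdot\rangle$ (linear in the first variable), $\mathcal{B}(\mathcal{H})$ is the algebra of bounded linear operators on $\mathcal{H}$, and $A\in\mathcal{B}(\mathcal{H})$ is a positive operator (i.e. $\langle Ax,x\rangle\ge 0$ for all $x$; not necessarily injective or with closed range). Put $\langle x,y\rangle_A=\langle Ax,y\rangle$ and $\|x\|_A=\sqrt{\langle x,x\rangle_A}$. An operator $R\in\mathcal{B}(\mathcal{H})$ is an $A$-adjoint of $T\in\mathcal{B}(\mathcal{H})$ if $\langle Tx,y\rangle_A=\langle x,Ry\rangle_A$ for all $x,y\in\mathcal{H}$. $\mathcal{B}_A(\mathcal{H})$ is the set of all $T\in\mathcal{B}(\mathcal{H})$ admitting an $A$-adjoint; equivalently, $R(T^*A)\subseteq R(A)$, where $R(\cdot)$ denotes range. For $T\in\mathcal{B}_A(\mathcal{H})$, $T^{\sharp_A}$ denotes the unique $A$-adjoint with range contained in $\overline{R(A)}$, i.e. the unique solution $X$ of $AX=T^*A$ with $R(X)\subseteq\overline{R(A)}$. For $T\in\mathcal{B}_A(\mathcal{H})$, the $A$-operator seminorm is $\|T\|_A=\sup\{\|Tx\|_A: x\in\mathcal{H},\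 \|x\|_A=1\}$ and the $A$-numerical radius is $w_A(T)=\sup\{|\langle Tx,x\rangle_A|: x\in\mathcal{H},\ \|x\|_A=1\}$. Write $w_A^2(T)=(w_A(T))^2$. *)

theory Defs
  imports "HOL-Analysis.Analysis"
begin

text \<open>
  A complex Hilbert space whose underlying real Banach space is the one of the library, so
  that \<^const>\<open>bounded_linear\<close>, \<^const>\<open>closure\<close> etc. refer to the norm topology of the inner
  product. The inner product is linear in the first variable.
\<close>

class complex_hilbert_space = banach +
  fixes scaleC :: "complex \<Rightarrow> 'a \<Rightarrow> 'a" (infixr \<open>*\<^sub>C\<close> 75)
    and cinner :: "'a \<Rightarrow> 'a \<Rightarrow> complex"
  assumes scaleC_add_right: "c *\<^sub>C (x + y) = c *\<^sub>C x + c *\<^sub>C y"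
    and scaleC_add_left: "(c + d) *\<^sub>C x = c *\<^sub>C x + d *\<^sub>C x"
    and scaleC_scaleC: "c *\<^sub>C d *\<^sub>C x = (c * d) *\<^sub>C x"
    and scaleC_of_real: "complex_of_real r *\<^sub>C x = r *\<^sub>R x"
    and cinner_add_left: "cinner (x + y) z = cinner x z + cinner y z"
    and cinner_scaleC_left: "cinner (c *\<^sub>C x) y = c * cinner x y"
    and cinner_commute: "cinner x y = cnj (cinner y x)"
    and cinner_ge_zero: "0 \<le> Re (cinner x x)"
    and cinner_eq_zero_iff: "cinner x x = 0 \<longleftrightarrow> x = 0"
    and norm_eq_sqrt_cinner: "norm x = sqrt (Re (cinner x x))"

instantiation complex :: complex_hilbert_space
begin

definition scaleC_complex :: "complex \<Rightarrow> complex \<Rightarrow> complex" where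
  "scaleC_complex c x = c * x"

definition cinner_complex :: "complex \<Rightarrow> complex \<Rightarrow> complex" where
  "cinner_complex x y = x * cnj y"

instance
  by standard
    (simp_all add: scaleC_complex_def cinner_complex_def algebra_simps scaleR_conv_of_real
      cmod_def power2_eq_square)

end

definition bounded_clinear :: "('a::complex_hilbert_space \<Rightarrow> 'a) \<Rightarrow> bool" where
  "bounded_clinear T \<longleftrightarrow> bounded_linear T \<and> (\<forall>c x. T (c *\<^sub>C x) = c *\<^sub>C T x)"

definition positive_operator :: "('a::complex_hilbert_space \<Rightarrow> 'a) \<Rightarrow> bool" where
  "positive_operator A \<longleftrightarrow> bounded_clinear A \<and> (\<forall>x. cinner (A x) x \<in> \<real>\<^sub>\<ge>\<^sub>0)"

definition A_inner :: "('a::complex_hilbert_space \<Rightarrow> 'a) \<Rightarrow> 'a \<Rightarrow> 'a \<Rightarrow> complex" where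
  "A_inner A x y = cinner (A x) y"

definition A_norm :: "('a::complex_hilbert_space \<Rightarrow> 'a) \<Rightarrow> 'a \<Rightarrow> real" where
  "A_norm A x = sqrt (Re (A_inner A x x))"

definition is_A_adjoint ::
    "('a::complex_hilbert_space \<Rightarrow> 'a) \<Rightarrow> ('a \<Rightarrow> 'a) \<Rightarrow> ('a \<Rightarrow> 'a) \<Rightarrow> bool" where
  "is_A_adjoint A T R \<longleftrightarrow>
     bounded_clinear R \<and> (\<forall>x y. A_inner A (T x) y = A_inner A x (R y))"

definition A_adjointable :: "('a::complex_hilbert_space \<Rightarrow> 'a) \<Rightarrow> ('a \<Rightarrow> 'a) set" where
  "A_adjointable A = {T. bounded_clinear T \<and> (\<exists>R. is_A_adjoint A T R)}"

definition A_sharp :: "('a::complex_hilbert_space \<Rightarrow> 'a) \<Rightarrow> ('a \<Rightarrow> 'a) \<Rightarrow> 'a \<Rightarrow> 'a" where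
  "A_sharp A T = (THE X. is_A_adjoint A T X \<and> range X \<subseteq> closure (range A))"

text \<open>
  Both suprema are taken in the ordered set of nonnegative reals. Inserting \<open>0\<close> changes nothing
  unless \<open>A = 0\<close>, when no \<open>x\<close> has \<open>A_norm A x = 1\<close>; the empty supremum is then \<open>0\<close>, whereas
  \<^term>\<open>Sup ({}::real set)\<close> is an unspecified number.
  For \<open>T\<close> in \<open>A_adjointable A\<close> both sets are bounded above.
\<close>

definition A_opnorm :: "('a::complex_hilbert_space \<Rightarrow> 'a) \<Rightarrow> ('a \<Rightarrow> 'a) \<Rightarrow> real" where
  "A_opnorm A T = Sup (insert 0 {A_norm A (T x) | x. A_norm A x = 1})"

definition A_numradius :: "('a::complex_hilbert_space \<Rightarrow> 'a) \<Rightarrow> ('a \<Rightarrow> 'a) \<Rightarrow> real" where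
  "A_numradius A T = Sup (insert 0 {cmod (A_inner A (T x) x) | x. A_norm A x = 1})"

end

theory Submission
  imports Defs
begin

text \<open>
  For \<open>\<parallel>x\<parallel>\<^sub>A = 1\<close> the Cauchy--Schwarz inequality bounds \<open>\<bar>\<langle>Tx, x\<rangle>\<^sub>A\<bar>\<close> both by \<open>\<parallel>Tx\<parallel>\<^sub>A\<close> and, moving
  \<open>T\<close> to the other side, by \<open>\<parallel>T\<^sup>\<sharp>x\<parallel>\<^sub>A\<close>. Hence its square is at most
  \<open>\<alpha>\<parallel>Tx\<parallel>\<^sub>A\<^sup>2 + (1 - \<alpha>)\<parallel>T\<^sup>\<sharp>x\<parallel>\<^sub>A\<^sup>2 = \<langle>(\<alpha>T\<^sup>\<sharp>T + (1 - \<alpha>)TT\<^sup>\<sharp>)x, x\<rangle>\<^sub>A\<close>, which one more application of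
  Cauchy--Schwarz bounds by the \<open>A\<close>-seminorm of the operator. The suprema are finite because
  \<open>T\<^sup>\<sharp>T\<close> and \<open>TT\<^sup>\<sharp>\<close> are \<open>A\<close>-selfadjoint, and the minimum over \<open>\<alpha>\<close> is attained because the
  seminorm is Lipschitz in \<open>\<alpha>\<close>. The operator \<open>T\<^sup>\<sharp>\<close> is obtained from any \<open>A\<close>-adjoint by composing
  with the orthogonal projection onto the closure of the range of \<open>A\<close>.
\<close>

section \<open>Semi-inner products on a complex Hilbert space\<close>

lemma scaleR_conv_scaleC: "r *\<^sub>R x = complex_of_real r *\<^sub>C (x::'a::complex_hilbert_space)"
  by (simp add: scaleC_of_real)

text \<open>Definiteness is left out so that \<open>A_inner A\<close> is an instance even when
  \<open>A\<close> has a kernel; \<open>cinner\<close> is another instance.\<close>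

locale semi_inner_product =
  fixes f :: "'a::complex_hilbert_space \<Rightarrow> 'a \<Rightarrow> complex"
  assumes add_left: "f (x + y) z = f x z + f y z"
    and scaleC_left: "f (c *\<^sub>C x) y = c * f x y"
    and commute: "f x y = cnj (f y x)"
    and nonneg: "0 \<le> Re (f x x)"
begin

definition snorm :: "'a \<Rightarrow> real" where
  "snorm x = sqrt (Re (f x x))"

lemma add_right: "f x (y + z) = f x y + f x z"
  by (metis add_left commute complex_cnj_add)

lemma scaleC_right: "f x (c *\<^sub>C y) = cnj c * f x y"
  by (metis scaleC_left commute complex_cnj_mult)

lemma scaleR_left: "f (r *\<^sub>R x) y = of_real r * f x y"
  by (simp add: scaleR_conv_scaleC scaleC_left)

lemma scaleR_right: "f x (r *\<^sub>R y) = of_real r * f x y"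
  by (simp add: scaleR_conv_scaleC scaleC_right)

lemma diff_left: "f (x - y) z = f x z - f y z"
  using add_left[of "x - y" y z] by simp

lemma diff_right: "f x (y - z) = f x y - f x z"
  using add_right[of x "y - z" z] by simp

lemmas sesquilinear =
  add_left add_right diff_left diff_right scaleC_left scaleC_right scaleR_left scaleR_right

lemma self_eq_snorm: "f x x = complex_of_real ((snorm x)\<^sup>2)"
  using commute[of x x] nonneg[of x] by (simp add: snorm_def complex_eq_iff)

lemma snorm_nonneg: "0 \<le> snorm x"
  by (simp add: snorm_def nonneg)

lemma Cauchy_Schwarz: "cmod (f x y) \<le> snorm x * snorm y"
proof -
  define c where "c = f x y"
  have f_yx: "f y x = cnj c"
    unfolding c_def by (rule commute)
  \<comment> \<open>The factor \<open>c\<close> in the vector subtracted from \<open>x\<close> makes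
    both cross terms equal to the real number -t |c|^2, so a real quadratic in \<open>t\<close>
    remains.\<close>
  have quadratic: "0 \<le> (snorm x)\<^sup>2 - 2 * t * (cmod c)\<^sup>2 + t\<^sup>2 * (cmod c)\<^sup>2 * (snorm y)\<^sup>2" for t
  proof -
    define z where "z = x - (of_real t * c) *\<^sub>C y"
    have "f z z = f x x - 2 * of_real t * (c * cnj c) + (of_real t)\<^sup>2 * (c * cnj c) * f y y"
      unfolding z_def sesquilinear f_yx c_def[symmetric]
      by (simp add: algebra_simps power2_eq_square)
    also have "\<dots> = of_real ((snorm x)\<^sup>2 - 2 * t * (cmod c)\<^sup>2 + t\<^sup>2 * (cmod c)\<^sup>2 * (snorm y)\<^sup>2)"
      by (simp add: self_eq_snorm complex_norm_square[symmetric])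
    finally show ?thesis
      using nonneg[of z] by (metis Re_complex_of_real)
  qed
  have "(cmod c)\<^sup>2 \<le> (snorm x * snorm y)\<^sup>2"
  proof (cases "snorm y = 0")
    case True
    have "(cmod c)\<^sup>2 = 0"
    proof (rule ccontr)
      assume ne: "(cmod c)\<^sup>2 \<noteq> 0"
      show False
        \<comment> \<open>The quadratic is affine in \<open>t\<close> here, since
          \<open>snorm y = 0\<close>; this \<open>t\<close> gives it the value -1.\<close>
        using quadratic[of "((snorm x)\<^sup>2 + 1) / (2 * (cmod c)\<^sup>2)"] True ne by simp
    qed
    then show ?thesis by simp
  next
    case False
    then have "0 \<le> (snorm x)\<^sup>2 - (cmod c)\<^sup>2 / (snorm y)\<^sup>2"
      \<comment> \<open>This \<open>t\<close> minimises the quadratic.\<close>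
      using quadratic[of "1 / (snorm y)\<^sup>2"] by (simp add: field_simps power2_eq_square)
    then show ?thesis
      using False by (simp add: field_simps power_mult_distrib)
  qed
  then show ?thesis
    unfolding c_def by (rule power2_le_imp_le) (simp add: snorm_nonneg)
qed

lemma snorm_triangle: "snorm (x + y) \<le> snorm x + snorm y"
proof (rule power2_le_imp_le)
  have "f (x + y) (x + y) = f x x + f y y + (f x y + cnj (f x y))"
    using commute[of y x] by (simp add: sesquilinear)
  then have "Re (f (x + y) (x + y)) = Re (f x x) + Re (f y y) + 2 * Re (f x y)"
    by simp
  then have "(snorm (x + y))\<^sup>2 = (snorm x)\<^sup>2 + (snorm y)\<^sup>2 + 2 * Re (f x y)"
    unfolding self_eq_snorm by simp
  also have "\<dots> \<le> (snorm x + snorm y)\<^sup>2"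
    using Cauchy_Schwarz[of x y] complex_Re_le_cmod[of "f x y"]
    by (simp add: power2_sum)
  finally show "(snorm (x + y))\<^sup>2 \<le> (snorm x + snorm y)\<^sup>2" .
qed (simp add: snorm_nonneg)

lemma snorm_scaleR: "snorm (r *\<^sub>R x) = \<bar>r\<bar> * snorm x"
proof -
  have "Re (f (r *\<^sub>R x) (r *\<^sub>R x)) = r\<^sup>2 * Re (f x x)"
    by (simp add: sesquilinear power2_eq_square)
  then show ?thesis
    by (simp add: snorm_def real_sqrt_mult)
qed

text \<open>Parallelogram law for z - x and z - y, whose sum is twice the vector from the midpoint
  of x and y to z. This form suits minimising sequences, because a subspace contains the
  midpoint.\<close>

lemma parallelogram:
  "(snorm (x - y))\<^sup>2 + 4 * (snorm (z - (1 / 2) *\<^sub>R (x + y)))\<^sup>2 =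
    2 * (snorm (z - x))\<^sup>2 + 2 * (snorm (z - y))\<^sup>2"
proof -
  have "f (x - y) (x - y) + 4 * f (z - (1 / 2) *\<^sub>R (x + y)) (z - (1 / 2) *\<^sub>R (x + y)) =
      2 * f (z - x) (z - x) + 2 * f (z - y) (z - y)"
    by (simp add: sesquilinear algebra_simps)
  then have "complex_of_real ((snorm (x - y))\<^sup>2 + 4 * (snorm (z - (1 / 2) *\<^sub>R (x + y)))\<^sup>2) =
      complex_of_real (2 * (snorm (z - x))\<^sup>2 + 2 * (snorm (z - y))\<^sup>2)"
    by (simp add: self_eq_snorm)
  then show ?thesis
    using of_real_eq_iff by blast
qed

text \<open>
  Selfadjointness gives \<open>\<parallel>S\<^sup>kx\<parallel>\<^sup>2 = \<langle>S\<^sup>2\<^sup>kx, x\<rangle> \<le> \<parallel>S\<^sup>2\<^sup>kx\<parallel>\<close> for the seminorm, so \<open>\<parallel>Sx\<parallel>\<close> raised to the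
  power \<open>2\<^sup>n\<close> grows at most like \<open>B\<close> raised to that power.
\<close>
lemma selfadjoint_snorm_le:
  assumes selfadjoint: "\<And>x y. f (S x) y = f x (S y)"
    and norm_S: "\<And>x. norm (S x) \<le> B * norm x" and "B > 0"
    and snorm_le: "\<And>x. snorm x \<le> K * norm x"
    and "snorm x = 1"
  shows "snorm (S x) \<le> B"
proof (rule ccontr)
  assume "\<not> snorm (S x) \<le> B"
  then have gt_1: "snorm (S x) / B > 1"
    using \<open>B > 0\<close> by simp
  have pow_adjoint: "f ((S ^^ k) u) v = f u ((S ^^ k) v)" for k u v
    by (induction k arbitrary: u v) (simp_all add: selfadjoint funpow_swap1)
  have double: "(snorm ((S ^^ k) x))\<^sup>2 \<le> snorm ((S ^^ (2 * k)) x)" for k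
  proof -
    have "complex_of_real ((snorm ((S ^^ k) x))\<^sup>2) = f ((S ^^ k) x) ((S ^^ k) x)"
      by (rule self_eq_snorm[symmetric])
    also have "\<dots> = f ((S ^^ (2 * k)) x) x"
      by (simp add: pow_adjoint[symmetric] mult_2 funpow_add)
    finally have "(snorm ((S ^^ k) x))\<^sup>2 = cmod (f ((S ^^ (2 * k)) x) x)"
      by (metis norm_of_real abs_power2)
    also have "\<dots> \<le> snorm ((S ^^ (2 * k)) x)"
      using Cauchy_Schwarz[of "(S ^^ (2 * k)) x" x] \<open>snorm x = 1\<close> by simp
    finally show ?thesis .
  qed
  have lower: "snorm (S x) ^ (2 ^ n) \<le> snorm ((S ^^ (2 ^ n)) x)" for n
  proof (induction n)
    case (Suc n)
    have "snorm (S x) ^ (2 ^ Suc n) = (snorm (S x) ^ (2 ^ n))\<^sup>2"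
      by (simp add: power_mult[symmetric] mult.commute)
    also have "\<dots> \<le> (snorm ((S ^^ (2 ^ n)) x))\<^sup>2"
      by (rule power_mono[OF Suc]) (simp add: snorm_nonneg)
    also have "\<dots> \<le> snorm ((S ^^ (2 ^ Suc n)) x)"
      using double[of "2 ^ n"] by simp
    finally show ?case .
  qed simp
  have norm_pow: "norm ((S ^^ k) x) \<le> B ^ k * norm x" for k
  proof (induction k)
    case (Suc k)
    have "norm ((S ^^ Suc k) x) \<le> B * norm ((S ^^ k) x)"
      using norm_S by simp
    also have "\<dots> \<le> B * (B ^ k * norm x)"
      using Suc \<open>B > 0\<close> by simp
    finally show ?case by simp
  qed simp
  have "0 < norm x"
  proof -
    have "snorm 0 = 0"
      using snorm_scaleR[of 0 x] by simp
    then show ?thesis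
      using \<open>snorm x = 1\<close> by auto
  qed
  have "K \<ge> 0"
    using snorm_le[of x] \<open>snorm x = 1\<close> \<open>0 < norm x\<close>
    by (smt (verit) mult_nonpos_nonneg)
  \<comment> \<open>The estimate \<open>lower\<close> concerns exponents of the form
    \<open>2 ^ n\<close> only; as the base exceeds 1 and n \<le> 2 ^ n, passing from
    \<open>n\<close> to \<open>2 ^ n\<close> preserves the strict inequality.\<close>
  obtain n where n: "K * norm x < (snorm (S x) / B) ^ n"
    using real_arch_pow[OF gt_1] by blast
  also have "\<dots> \<le> (snorm (S x) / B) ^ (2 ^ n)"
    by (rule power_increasing) (use gt_1 in auto)
  also have "\<dots> \<le> K * norm x"
  proof -
    have "snorm (S x) ^ (2 ^ n) \<le> K * norm ((S ^^ (2 ^ n)) x)"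
      using lower snorm_le order_trans by blast
    also have "\<dots> \<le> K * (B ^ (2 ^ n) * norm x)"
      by (rule mult_left_mono[OF norm_pow \<open>K \<ge> 0\<close>])
    finally show ?thesis
      using \<open>B > 0\<close> by (simp add: power_divide field_simps)
  qed
  finally show False by simp
qed

end

section \<open>The Hilbert space inner product and its norm\<close>

interpretation cinner: semi_inner_product cinner
  rewrites "semi_inner_product.snorm cinner = norm"
proof -
  show "semi_inner_product (cinner :: 'a \<Rightarrow> 'a \<Rightarrow> complex)"
    by unfold_locales
      (rule cinner_add_left cinner_scaleC_left cinner_commute cinner_ge_zero)+
  then interpret semi_inner_product "cinner :: 'a \<Rightarrow> 'a \<Rightarrow> complex" .
  \<comment> \<open>With this rewriting, the Cauchy-Schwarz inequality and the parallelogram law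
    speak of the norm of the type class.\<close>
  show "snorm = norm"
    by (simp add: fun_eq_iff snorm_def norm_eq_sqrt_cinner)
qed

lemma norm_scaleC: "norm (c *\<^sub>C x) = cmod c * norm (x::'a::complex_hilbert_space)"
proof -
  have "cinner (c *\<^sub>C x) (c *\<^sub>C x) = (c * cnj c) * cinner x x"
    by (simp add: cinner.sesquilinear)
  then have "complex_of_real ((norm (c *\<^sub>C x))\<^sup>2) = complex_of_real ((cmod c * norm x)\<^sup>2)"
    unfolding cinner.self_eq_snorm
    by (simp add: complex_norm_square[symmetric] power_mult_distrib)
  then show ?thesis
    by (metis of_real_eq_iff power2_eq_iff_nonneg norm_ge_zero mult_nonneg_nonneg)
qed

lemma bounded_linear_scaleC: "bounded_linear (\<lambda>x::'a::complex_hilbert_space. c *\<^sub>C x)"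
  by (rule bounded_linear_intro[where K = "cmod c"])
    (simp_all add: scaleC_add_right scaleR_conv_scaleC scaleC_scaleC norm_scaleC mult.commute)

lemma bounded_linear_cinner_left: "bounded_linear (\<lambda>x::'a::complex_hilbert_space. cinner x y)"
  by (rule bounded_linear_intro[where K = "norm y"])
    (simp_all add: cinner.sesquilinear cinner.Cauchy_Schwarz scaleR_conv_of_real)

section \<open>Closed subspaces and orthogonal projections\<close>

lemma subspace_closure:
  fixes S :: "'a::real_normed_vector set"
  assumes "subspace S"
  shows "subspace (closure S)"
proof (rule subspaceI)
  show "0 \<in> closure S"
    using subspace_0[OF assms] closure_subset by blast
  show "x + y \<in> closure S" if x: "x \<in> closure S" and y: "y \<in> closure S" for x y
  proof -
    obtain u where "\<forall>n. u n \<in> S" "u \<longlonglongrightarrow> x"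
      using x unfolding closure_sequential by blast
    moreover obtain v where "\<forall>n. v n \<in> S" "v \<longlonglongrightarrow> y"
      using y unfolding closure_sequential by blast
    ultimately have "\<And>n. u n + v n \<in> S" "(\<lambda>n. u n + v n) \<longlonglongrightarrow> x + y"
      by (auto intro: subspace_add[OF assms] tendsto_add)
    then show ?thesis
      unfolding closure_sequential by (intro exI[of _ "\<lambda>n. u n + v n"] conjI allI)
  qed
  show "c *\<^sub>R x \<in> closure S" if x: "x \<in> closure S" for c x
  proof -
    obtain u where "\<forall>n. u n \<in> S" "u \<longlonglongrightarrow> x"
      using x unfolding closure_sequential by blast
    then have "\<And>n. c *\<^sub>R u n \<in> S" "(\<lambda>n. c *\<^sub>R u n) \<longlonglongrightarrow> c *\<^sub>R x"
      by (auto intro: subspace_scale[OF assms] tendsto_scaleR tendsto_const)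
    then show ?thesis
      unfolding closure_sequential by (intro exI[of _ "\<lambda>n. c *\<^sub>R u n"] conjI allI)
  qed
qed

text \<open>By the parallelogram law a sequence in M minimising the distance to z is Cauchy. Its
  limit is a nearest point p, and if z - p were not orthogonal to some m in M, moving p along a
  multiple of m would come closer to z.\<close>

lemma closed_subspace_projection_exists:
  fixes M :: "'a::complex_hilbert_space set"
  assumes "closed M" and sub: "subspace M" and scaleC: "\<And>c m. m \<in> M \<Longrightarrow> c *\<^sub>C m \<in> M"
  obtains p where "p \<in> M" and "\<And>m. m \<in> M \<Longrightarrow> cinner (z - p) m = 0"
proof -
  have ne: "M \<noteq> {}"
    using subspace_0[OF sub] by auto
  define d where "d = infdist z M"
  have "d \<ge> 0"
    by (simp add: d_def infdist_nonneg)
  have d_le: "d\<^sup>2 \<le> (norm (z - m))\<^sup>2" if "m \<in> M" for m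
    using infdist_le[OF that, of z] \<open>d \<ge> 0\<close> by (simp add: d_def dist_norm power_mono)
  have "\<exists>m\<in>M. (norm (z - m))\<^sup>2 < d\<^sup>2 + e" if "e > 0" for e
  proof -
    have "sqrt (d\<^sup>2 + e) > d"
      using that by (simp add: real_less_rsqrt)
    then obtain m where m: "m \<in> M" "dist z m < sqrt (d\<^sup>2 + e)"
      using ne by (auto simp: d_def infdist_def cInf_less_iff)
    then have "(norm (z - m))\<^sup>2 < (sqrt (d\<^sup>2 + e))\<^sup>2"
      by (intro power_strict_mono) (auto simp: dist_norm)
    then show ?thesis
      using m that by auto
  qed
  then have "\<exists>m\<in>M. (norm (z - m))\<^sup>2 < d\<^sup>2 + inverse (real (Suc n))" for n
    by simp
  then obtain s where s_in: "\<And>n. s n \<in> M"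
    and s: "\<And>n. (norm (z - s n))\<^sup>2 < d\<^sup>2 + inverse (real (Suc n))"
    by metis
  \<comment> \<open>The midpoint lies in M, so its squared distance to z is at least d^2; in the
    parallelogram law the terms 4 d^2 cancel and only the errors remain.\<close>
  have gap: "(norm (s m - s n))\<^sup>2 \<le> 2 * inverse (real (Suc m)) + 2 * inverse (real (Suc n))" for m n
  proof -
    have "(1 / 2) *\<^sub>R (s m + s n) \<in> M"
      by (intro subspace_scale[OF sub] subspace_add[OF sub] s_in)
    then show ?thesis
      using cinner.parallelogram[of "s m" "s n" z] s[of m] s[of n] d_le by fastforce
  qed
  have "Cauchy s"
  proof (rule metric_CauchyI)
    fix e :: real
    assume "e > 0"
    \<comment> \<open>Beyond \<open>k\<close>, each of the two terms in \<open>gap\<close> is below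
      e^2 / 2.\<close>
    then obtain k where k: "inverse (real (Suc k)) < e\<^sup>2 / 4"
      using reals_Archimedean[of "e\<^sup>2 / 4"] by auto
    have "dist (s m) (s n) < e" if "m \<ge> k" "n \<ge> k" for m n
    proof -
      have "inverse (real (Suc m)) \<le> inverse (real (Suc k))"
        "inverse (real (Suc n)) \<le> inverse (real (Suc k))"
        using that by (auto intro!: le_imp_inverse_le)
      then have "(norm (s m - s n))\<^sup>2 < e\<^sup>2"
        using gap[of m n] k by linarith
      then show ?thesis
        using \<open>e > 0\<close> by (simp add: dist_norm power2_less_imp_less)
    qed
    then show "\<exists>k. \<forall>m\<ge>k. \<forall>n\<ge>k. dist (s m) (s n) < e"
      by blast
  qed
  then obtain p where lim: "s \<longlonglongrightarrow> p"
    using Cauchy_convergent convergent_def by blast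
  then have "p \<in> M"
    using \<open>closed M\<close> s_in closed_sequentially by blast
  have "(\<lambda>n. (norm (z - s n))\<^sup>2) \<longlonglongrightarrow> (norm (z - p))\<^sup>2"
    by (intro tendsto_intros lim)
  moreover have "(\<lambda>n. d\<^sup>2 + inverse (real (Suc n))) \<longlonglongrightarrow> d\<^sup>2 + 0"
    by (intro tendsto_intros LIMSEQ_inverse_real_of_nat)
  ultimately have "(norm (z - p))\<^sup>2 \<le> d\<^sup>2 + 0"
    by (rule LIMSEQ_le) (use s less_imp_le in blast)
  then have nearest: "(norm (z - p))\<^sup>2 \<le> (norm (z - m))\<^sup>2" if "m \<in> M" for m
    using d_le[OF that] by linarith
  have "cinner (z - p) m = 0" if "m \<in> M" for m
  proof (rule ccontr)
    assume "cinner (z - p) m \<noteq> 0"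
    define c where "c = cinner (z - p) m"
    \<comment> \<open>Subtracting t c m from z - p lowers the squared norm by (2 t - t^2 |m|^2)
      |c|^2. The summand 1 in the denominator ensures t |m|^2 < 1, which makes this amount positive,
      and avoids a separate case m = 0.\<close>
    define t where "t = 1 / (1 + (norm m)\<^sup>2)"
    define u where "u = z - p - (of_real t * c) *\<^sub>C m"
    have cnj_c: "cinner m (z - p) = cnj c"
      unfolding c_def by (rule cinner_commute)
    have "cinner u u = cinner (z - p) (z - p) - 2 * of_real t * (c * cnj c)
        + (of_real t)\<^sup>2 * (c * cnj c) * cinner m m"
      unfolding u_def cinner.diff_left[of "z - p"] cinner.diff_right[of _ "z - p"]
        cinner.scaleC_left cinner.scaleC_right cnj_c c_def[symmetric]
      by (simp add: algebra_simps power2_eq_square)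
    also have "\<dots> = of_real ((norm (z - p))\<^sup>2 - 2 * t * (cmod c)\<^sup>2
        + t\<^sup>2 * (cmod c)\<^sup>2 * (norm m)\<^sup>2)"
      by (simp add: cinner.self_eq_snorm complex_norm_square[symmetric])
    finally have norm_u: "(norm u)\<^sup>2 =
        (norm (z - p))\<^sup>2 - 2 * t * (cmod c)\<^sup>2 + t\<^sup>2 * (cmod c)\<^sup>2 * (norm m)\<^sup>2"
      unfolding cinner.self_eq_snorm using of_real_eq_iff by blast
    have "p + (of_real t * c) *\<^sub>C m \<in> M"
      by (intro subspace_add[OF sub] \<open>p \<in> M\<close> scaleC that)
    then have "(norm (z - p))\<^sup>2 \<le> (norm u)\<^sup>2"
      using nearest by (simp add: u_def diff_diff_eq)
    then have "(2 * t - t\<^sup>2 * (norm m)\<^sup>2) * (cmod c)\<^sup>2 \<le> 0"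
      unfolding norm_u by (simp add: algebra_simps)
    moreover have "2 * t - t\<^sup>2 * (norm m)\<^sup>2 > 0"
    proof -
      have "t > 0"
        by (simp add: t_def add_pos_nonneg)
      moreover have "t * (norm m)\<^sup>2 < 1"
        by (simp add: t_def add_pos_nonneg)
      then have "t * (t * (norm m)\<^sup>2) < t * 1"
        using \<open>t > 0\<close> by (rule mult_strict_left_mono)
      ultimately show ?thesis
        by (simp add: power2_eq_square)
    qed
    ultimately show False
      using \<open>cinner (z - p) m \<noteq> 0\<close> by (simp add: c_def mult_le_0_iff)
  qed
  then show thesis
    using that \<open>p \<in> M\<close> by blast
qed

text \<open>Orthogonality determines the point of M, so \<open>P\<close> is linear because sums and
  multiples of chosen points satisfy the same condition. The bound |P x| \<le> |x| is Cauchy-Schwarz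
  applied to <P x, P x> = <x, P x>.\<close>

lemma bounded_clinear_closed_subspace_projection:
  fixes M :: "'a::complex_hilbert_space set"
  assumes "closed M" and sub: "subspace M" and scaleC: "\<And>c m. m \<in> M \<Longrightarrow> c *\<^sub>C m \<in> M"
  obtains P where "bounded_clinear P" and "range P \<subseteq> M"
    and "\<And>z m. m \<in> M \<Longrightarrow> cinner (z - P z) m = 0"
proof -
  have "\<forall>z. \<exists>p. p \<in> M \<and> (\<forall>m\<in>M. cinner (z - p) m = 0)"
    using closed_subspace_projection_exists[OF assms] by metis
  then obtain P where P_in: "\<And>z. P z \<in> M"
    and orth: "\<And>z m. m \<in> M \<Longrightarrow> cinner (z - P z) m = 0"
    by metis
  \<comment> \<open>The difference of two candidates lies in M and is orthogonal to M, hence to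
    itself.\<close>
  have unique: "P z = p" if "p \<in> M" and "\<And>m. m \<in> M \<Longrightarrow> cinner (z - p) m = 0" for z p
  proof -
    have "P z - p \<in> M"
      by (intro subspace_diff[OF sub] P_in that)
    then have "cinner (P z - p) (P z - p) = 0"
      using orth[of "P z - p" z] that(2)[of "P z - p"]
      by (simp add: cinner.diff_left)
    then show ?thesis
      by (simp add: cinner_eq_zero_iff)
  qed
  have P_add: "P (x + y) = P x + P y" for x y
  proof (rule unique)
    show "P x + P y \<in> M"
      by (intro subspace_add[OF sub] P_in)
    show "cinner (x + y - (P x + P y)) m = 0" if "m \<in> M" for m
      using orth[OF that, of x] orth[OF that, of y] by (simp add: cinner.sesquilinear)
  qed
  have P_scaleC: "P (c *\<^sub>C x) = c *\<^sub>C P x" for c x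
  proof (rule unique)
    show "c *\<^sub>C P x \<in> M"
      by (intro scaleC P_in)
    show "cinner (c *\<^sub>C x - c *\<^sub>C P x) m = 0" if "m \<in> M" for m
      using orth[OF that, of x] by (simp add: cinner.sesquilinear)
  qed
  have norm_P: "norm (P x) \<le> norm x" for x
  proof -
    have "cinner (P x) (P x) = cinner x (P x)"
      using orth[OF P_in, of x x] by (simp add: cinner.diff_left)
    then have "cmod (cinner (P x) (P x)) \<le> norm x * norm (P x)"
      using cinner.Cauchy_Schwarz by metis
    then have "norm (P x) * norm (P x) \<le> norm x * norm (P x)"
      by (simp add: cinner.self_eq_snorm norm_power power2_eq_square norm_mult)
    then show ?thesis
      by (metis mult_right_le_imp_le norm_ge_zero norm_le_zero_iff order_le_less)
  qed
  have "bounded_linear P"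
    by (rule bounded_linear_intro[where K = 1])
      (simp_all add: P_add scaleR_conv_scaleC P_scaleC norm_P)
  then have "bounded_clinear P"
    by (simp add: bounded_clinear_def P_scaleC)
  then show thesis
    using that P_in orth by blast
qed

section \<open>The semi-inner product given by \<open>A\<close> and the operator
  \<open>A_sharp A T\<close>\<close>

lemma bounded_clinear_compose:
  "bounded_clinear S \<Longrightarrow> bounded_clinear T \<Longrightarrow> bounded_clinear (\<lambda>x. S (T x))"
  by (simp add: bounded_clinear_def bounded_linear_compose)

lemma A_norm_eq_snorm: "A_norm A = semi_inner_product.snorm (A_inner A)"
  if "semi_inner_product (A_inner A)"
  using that by (simp add: fun_eq_iff A_norm_def semi_inner_product.snorm_def)

lemma positive_operator_semi_inner_product:
  assumes "positive_operator A"
  shows "semi_inner_product (A_inner A)"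
proof
  have lin: "bounded_linear A" and scale: "\<And>c x. A (c *\<^sub>C x) = c *\<^sub>C A x"
    and pos: "\<And>x. cinner (A x) x \<in> \<real>\<^sub>\<ge>\<^sub>0"
    using assms by (auto simp: positive_operator_def bounded_clinear_def)
  have A_add: "A (x + y) = A x + A y" for x y
    by (rule linear_add[OF bounded_linear.linear[OF lin]])
  show "A_inner A (x + y) z = A_inner A x z + A_inner A y z" for x y z
    by (simp add: A_inner_def A_add cinner_add_left)
  show "A_inner A (c *\<^sub>C x) y = c * A_inner A x y" for c x y
    by (simp add: A_inner_def scale cinner_scaleC_left)
  have im: "Im (cinner (A x) x) = 0" and re: "0 \<le> Re (cinner (A x) x)" for x
    using pos[of x] by (auto simp: complex_nonneg_Reals_iff)
  show "0 \<le> Re (A_inner A x x)" for x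
    by (simp add: A_inner_def re)
  \<comment> \<open>Polarisation: realness of the diagonal at x + y relates the imaginary parts of
    the two values, and at x + i y their real parts.\<close>
  show "A_inner A x y = cnj (A_inner A y x)" for x y
    using im[of "x + y"] im[of "x + \<i> *\<^sub>C y"] im[of x] im[of y]
    by (simp add: A_inner_def A_add scale cinner.sesquilinear complex_eq_iff)
qed

text \<open>\<open>A_sharp\<close> is a definite description, so unique existence has to come first.
  Projecting the values of an adjoint into \<open>M\<close> keeps it an adjoint, since the discarded
  component is orthogonal to the range of \<open>A\<close>.\<close>

lemma A_sharp_is_A_adjoint:
  fixes A T :: "'a::complex_hilbert_space \<Rightarrow> 'a"
  assumes "bounded_clinear A" and "T \<in> A_adjointable A"
  shows "is_A_adjoint A T (A_sharp A T)"
proof -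
  obtain R where R: "is_A_adjoint A T R"
    using assms(2) by (auto simp: A_adjointable_def)
  have lin: "bounded_linear A" and scale: "\<And>c x. A (c *\<^sub>C x) = c *\<^sub>C A x"
    using assms(1) by (auto simp: bounded_clinear_def)
  define M where "M = closure (range A)"
  have "closed M"
    by (simp add: M_def)
  have sub: "subspace M"
    unfolding M_def
    by (intro subspace_closure linear_subspace_image bounded_linear.linear lin subspace_UNIV)
  have M_scaleC: "c *\<^sub>C m \<in> M" if "m \<in> M" for c m
  proof -
    have "c *\<^sub>C m \<in> closure ((\<lambda>x. c *\<^sub>C x) ` range A)"
      using closure_bounded_linear_image_subset[OF bounded_linear_scaleC, of c "range A"] that
      by (auto simp: M_def)
    moreover have "(\<lambda>x. c *\<^sub>C x) ` range A \<subseteq> range A"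
      by (auto simp: scale[symmetric])
    ultimately show ?thesis
      unfolding M_def using closure_mono by blast
  qed
  obtain P where P: "bounded_clinear P" "range P \<subseteq> M"
    and orth: "\<And>z m. m \<in> M \<Longrightarrow> cinner (z - P z) m = 0"
    using bounded_clinear_closed_subspace_projection[OF \<open>closed M\<close> sub M_scaleC] by blast
  have A_in: "A x \<in> M" for x
    unfolding M_def by (rule subsetD[OF closure_subset]) simp
  have "\<exists>!X. is_A_adjoint A T X \<and> range X \<subseteq> M"
  proof (rule ex_ex1I)
    have "cinner (A x) (z - P z) = 0" for x z
      using orth[OF A_in, of z x] cinner_commute[of "A x" "z - P z"] by simp
    then have "is_A_adjoint A T (\<lambda>x. P (R x))"
      using R bounded_clinear_compose[OF P(1)]
      by (simp add: is_A_adjoint_def A_inner_def cinner.diff_right)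
    then show "\<exists>X. is_A_adjoint A T X \<and> range X \<subseteq> M"
      using P(2) by blast
  next
    fix X Y
    assume X: "is_A_adjoint A T X \<and> range X \<subseteq> M" and Y: "is_A_adjoint A T Y \<and> range Y \<subseteq> M"
    show "X = Y"
    proof
      fix y
      have "X y - Y y \<in> M"
        using X Y by (intro subspace_diff[OF sub]) auto
      \<comment> \<open>Both adjoints have the same products with the range of \<open>A\<close>, and
        orthogonality passes to its closure \<open>M\<close>. As \<open>M\<close> contains X y - Y
        y, this vector is orthogonal to itself.\<close>
      moreover have "M \<subseteq> {v. cinner v (X y - Y y) = 0}"
        unfolding M_def
      proof (rule closure_minimal)
        show "range A \<subseteq> {v. cinner v (X y - Y y) = 0}"
          using X Y by (auto simp: is_A_adjoint_def A_inner_def cinner.diff_right)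
        show "closed {v. cinner v (X y - Y y) = 0}"
          by (intro closed_Collect_eq continuous_intros
              bounded_linear.continuous_on[OF bounded_linear_cinner_left])
      qed
      ultimately show "X y = Y y"
        using cinner_eq_zero_iff[of "X y - Y y"] by auto
    qed
  qed
  from theI'[OF this] show ?thesis
    by (simp add: A_sharp_def M_def)
qed

section \<open>Operator seminorm and numerical radius as suprema\<close>

lemma A_norm_le_A_opnorm:
  assumes "\<And>x. A_norm A x = 1 \<Longrightarrow> A_norm A (S x) \<le> C" and "A_norm A x = 1"
  shows "A_norm A (S x) \<le> A_opnorm A S"
  unfolding A_opnorm_def
proof (rule cSup_upper)
  \<comment> \<open>A real \<open>Sup\<close> dominates its members only once the set is known to be
    bounded above, which the uniform bound \<open>C\<close> supplies.\<close>
  show "bdd_above (insert 0 {A_norm A (S x) | x. A_norm A x = 1})"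
    using assms(1) by (auto intro!: bdd_aboveI[of _ C])
qed (use assms(2) in auto)

lemma A_opnorm_nonneg:
  assumes "\<And>x. A_norm A x = 1 \<Longrightarrow> A_norm A (S x) \<le> C"
  shows "0 \<le> A_opnorm A S"
  unfolding A_opnorm_def
proof (rule cSup_upper)
  show "bdd_above (insert 0 {A_norm A (S x) | x. A_norm A x = 1})"
    using assms by (auto intro!: bdd_aboveI[of _ C])
qed simp

text \<open>The condition \<open>0 \<le> C\<close> handles the element 0 inserted in the
  definition.\<close>

lemma A_opnorm_le:
  assumes "\<And>x. A_norm A x = 1 \<Longrightarrow> A_norm A (S x) \<le> C" and "0 \<le> C"
  shows "A_opnorm A S \<le> C"
  unfolding A_opnorm_def using assms by (intro cSup_least) auto

lemma A_numradius_power2_le: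
  assumes "\<And>x. A_norm A x = 1 \<Longrightarrow> (cmod (A_inner A (T x) x))\<^sup>2 \<le> C" and "0 \<le> C"
  shows "(A_numradius A T)\<^sup>2 \<le> C"
proof -
  let ?V = "insert 0 {cmod (A_inner A (T x) x) | x. A_norm A x = 1}"
  have le: "v \<le> sqrt C" if "v \<in> ?V" for v
    using that assms by (auto intro: real_le_rsqrt)
  have "A_numradius A T \<le> sqrt C"
    unfolding A_numradius_def using le by (intro cSup_least) auto
  moreover have "0 \<le> A_numradius A T"
    unfolding A_numradius_def using le by (intro cSup_upper bdd_aboveI[of _ "sqrt C"]) auto
  ultimately have "(A_numradius A T)\<^sup>2 \<le> (sqrt C)\<^sup>2"
    by (rule power_mono)
  then show ?thesis
    using \<open>0 \<le> C\<close> by simp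
qed

text \<open>Boundedness in the Hilbert norm does not by itself bound the seminorm: an operator may
  move a kernel vector of \<open>A\<close> out of the kernel. Selfadjointness rules this out, and
  \<open>selfadjoint_snorm_le\<close> carries the same constant over. Its comparison constant is
  \<open>sqrt K\<close>, because <A x, x> \<le> K |x|^2.\<close>

lemma A_selfadjoint_A_norm_bounded:
  assumes "positive_operator A" and "bounded_linear S"
    and "\<And>x y. A_inner A (S x) y = A_inner A x (S y)"
  obtains B where "\<And>x. A_norm A x = 1 \<Longrightarrow> A_norm A (S x) \<le> B"
proof -
  interpret semi_inner_product "A_inner A"
    using assms(1) by (rule positive_operator_semi_inner_product)
  obtain B where B: "B > 0" "\<And>x. norm (S x) \<le> norm x * B"
    using bounded_linear.pos_bounded[OF assms(2)] by blast
  have "bounded_linear A"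
    using assms(1) by (simp add: positive_operator_def bounded_clinear_def)
  then obtain K where K: "K > 0" "\<And>x. norm (A x) \<le> norm x * K"
    using bounded_linear.pos_bounded by blast
  have snorm_le: "snorm x \<le> sqrt K * norm x" for x
  proof (rule power2_le_imp_le)
    have "(snorm x)\<^sup>2 = Re (cinner (A x) x)"
      using nonneg[of x] by (simp add: snorm_def A_inner_def)
    also have "\<dots> \<le> norm (A x) * norm x"
      using complex_Re_le_cmod cinner.Cauchy_Schwarz order_trans by blast
    also have "\<dots> \<le> norm x * K * norm x"
      by (intro mult_right_mono K) simp
    also have "\<dots> = (sqrt K * norm x)\<^sup>2"
      using \<open>K > 0\<close> by (simp add: power_mult_distrib power2_eq_square)
    finally show "(snorm x)\<^sup>2 \<le> (sqrt K * norm x)\<^sup>2" .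
  qed (use \<open>K > 0\<close> in simp)
  have "norm (S x) \<le> B * norm x" for x
    using B(2)[of x] by (simp add: mult.commute)
  then have "snorm (S x) \<le> B" if "snorm x = 1" for x
    by (rule selfadjoint_snorm_le[OF assms(3) _ B(1) snorm_le that])
  then show thesis
    by (intro that[of B]) (simp add: A_norm_eq_snorm[OF semi_inner_product_axioms])
qed

text \<open>The operators at \<alpha> and \<beta> differ by (\<alpha> - \<beta>)(P - Q), so the
  triangle inequality for the seminorm makes the function Lipschitz.\<close>

lemma A_opnorm_segment_continuous:
  assumes "positive_operator A"
    and P: "\<And>x. A_norm A x = 1 \<Longrightarrow> A_norm A (P x) \<le> B"
    and Q: "\<And>x. A_norm A x = 1 \<Longrightarrow> A_norm A (Q x) \<le> C"
  shows "continuous_on UNIV (\<lambda>\<alpha>. A_opnorm A (\<lambda>x. \<alpha> *\<^sub>R P x + (1 - \<alpha>) *\<^sub>R Q x))"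
    (is "continuous_on UNIV ?N")
proof -
  interpret semi_inner_product "A_inner A"
    using assms(1) by (rule positive_operator_semi_inner_product)
  note [simp] = A_norm_eq_snorm[OF semi_inner_product_axioms]
  \<comment> \<open>Absolute values, because \<open>B\<close> and \<open>C\<close> may be negative
    when no vector has seminorm 1.\<close>
  define L where "L = \<bar>B\<bar> + \<bar>C\<bar>"
  have "L \<ge> 0"
    by (simp add: L_def)
  let ?S = "\<lambda>\<alpha> x. \<alpha> *\<^sub>R P x + (1 - \<alpha>) *\<^sub>R Q x"
  have combine: "snorm (r *\<^sub>R P x + t *\<^sub>R Q x) \<le> \<bar>r\<bar> * \<bar>B\<bar> + \<bar>t\<bar> * \<bar>C\<bar>" if "snorm x = 1" for r t x
  proof -
    have "\<bar>r\<bar> * snorm (P x) \<le> \<bar>r\<bar> * \<bar>B\<bar>" "\<bar>t\<bar> * snorm (Q x) \<le> \<bar>t\<bar> * \<bar>C\<bar>"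
      using P[of x] Q[of x] that by (auto intro!: mult_left_mono)
    then show ?thesis
      using snorm_triangle[of "r *\<^sub>R P x" "t *\<^sub>R Q x"] by (simp add: snorm_scaleR)
  qed
  have bound: "A_norm A (?S \<alpha> x) \<le> \<bar>\<alpha>\<bar> * \<bar>B\<bar> + \<bar>1 - \<alpha>\<bar> * \<bar>C\<bar>" if "A_norm A x = 1" for \<alpha> x
    using combine that by simp
  have step: "?N \<alpha> \<le> ?N \<beta> + L * \<bar>\<alpha> - \<beta>\<bar>" for \<alpha> \<beta>
  proof (rule A_opnorm_le)
    show "0 \<le> ?N \<beta> + L * \<bar>\<alpha> - \<beta>\<bar>"
      using A_opnorm_nonneg[of A "?S \<beta>", OF bound] \<open>L \<ge> 0\<close> by simp
    fix x
    assume x: "A_norm A x = 1"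
    have "?S \<alpha> x = ?S \<beta> x + ((\<alpha> - \<beta>) *\<^sub>R P x + (\<beta> - \<alpha>) *\<^sub>R Q x)"
      by (simp add: algebra_simps)
    then have "snorm (?S \<alpha> x) \<le> snorm (?S \<beta> x) + snorm ((\<alpha> - \<beta>) *\<^sub>R P x + (\<beta> - \<alpha>) *\<^sub>R Q x)"
      using snorm_triangle by metis
    also have "\<dots> \<le> ?N \<beta> + (\<bar>\<alpha> - \<beta>\<bar> * \<bar>B\<bar> + \<bar>\<beta> - \<alpha>\<bar> * \<bar>C\<bar>)"
      using A_norm_le_A_opnorm[of A "?S \<beta>", OF bound x] combine x
      by (intro add_mono) auto
    also have "\<dots> = ?N \<beta> + L * \<bar>\<alpha> - \<beta>\<bar>"
      by (simp add: L_def abs_minus_commute algebra_simps)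
    finally show "A_norm A (?S \<alpha> x) \<le> ?N \<beta> + L * \<bar>\<alpha> - \<beta>\<bar>"
      by simp
  qed
  have "L-lipschitz_on UNIV ?N"
  proof (rule lipschitz_onI)
    show "dist (?N \<alpha>) (?N \<beta>) \<le> L * dist \<alpha> \<beta>" for \<alpha> \<beta>
      using step[of \<alpha> \<beta>] step[of \<beta> \<alpha>] by (simp add: dist_real_def abs_le_iff abs_minus_commute)
  qed (rule \<open>L \<ge> 0\<close>)
  then show ?thesis
    by (rule lipschitz_on_continuous_on)
qed

text \<open>A minimum has to be attained, so the conclusion exhibits a minimiser through
  \<open>is_arg_min\<close>; the inequality at \<beta> then yields it for every \<alpha> between 0
  and 1.\<close>

theorem theorem2p1:
  fixes A T :: "'a::complex_hilbert_space \<Rightarrow> 'a"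
  assumes "positive_operator A"
    and "T \<in> A_adjointable A"
  shows "let N = (\<lambda>\<alpha>::real. A_opnorm A
                (\<lambda>x. \<alpha> *\<^sub>R A_sharp A T (T x) + (1 - \<alpha>) *\<^sub>R T (A_sharp A T x)))
         in \<exists>\<beta>. is_arg_min N (\<lambda>\<alpha>. 0 \<le> \<alpha> \<and> \<alpha> \<le> 1) \<beta> \<and> (A_numradius A T)\<^sup>2 \<le> N \<beta>"
proof -
  interpret semi_inner_product "A_inner A"
    using assms(1) by (rule positive_operator_semi_inner_product)
  note A_norm = A_norm_eq_snorm[OF semi_inner_product_axioms]
  define X where "X = A_sharp A T"
  have "is_A_adjoint A T X"
    using A_sharp_is_A_adjoint assms by (auto simp: X_def positive_operator_def)
  then have X: "bounded_clinear X" and adj: "A_inner A (T x) y = A_inner A x (X y)" for x y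
    by (auto simp: is_A_adjoint_def)
  have T: "bounded_clinear T"
    using assms(2) by (simp add: A_adjointable_def)
  \<comment> \<open>Hermitian symmetry turns \<open>adj\<close> around, so \<open>T\<close> is also
    an adjoint of \<open>X\<close>; both products of \<open>T\<close> and \<open>X\<close> are
    therefore selfadjoint for \<open>A_inner A\<close>.\<close>
  have adj': "A_inner A (X x) y = A_inner A x (T y)" for x y
    using adj[of y x] commute[of "X x" y] commute[of x "T y"] by simp
  obtain B where B: "\<And>x. A_norm A x = 1 \<Longrightarrow> A_norm A (X (T x)) \<le> B"
  proof (rule A_selfadjoint_A_norm_bounded[OF assms(1)])
    show "bounded_linear (\<lambda>x. X (T x))"
      using bounded_clinear_compose[OF X T] by (simp add: bounded_clinear_def)
    show "A_inner A (X (T x)) y = A_inner A x (X (T y))" for x y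
      by (simp add: adj adj')
  qed blast
  obtain C where C: "\<And>x. A_norm A x = 1 \<Longrightarrow> A_norm A (T (X x)) \<le> C"
  proof (rule A_selfadjoint_A_norm_bounded[OF assms(1)])
    show "bounded_linear (\<lambda>x. T (X x))"
      using bounded_clinear_compose[OF T X] by (simp add: bounded_clinear_def)
    show "A_inner A (T (X x)) y = A_inner A x (T (X y))" for x y
      by (simp add: adj adj')
  qed blast
  let ?S = "\<lambda>\<alpha> x. \<alpha> *\<^sub>R X (T x) + (1 - \<alpha>) *\<^sub>R T (X x)"
  let ?N = "\<lambda>\<alpha>. A_opnorm A (?S \<alpha>)"
  have "continuous_on {0..1} ?N"
    by (rule continuous_on_subset[OF A_opnorm_segment_continuous[OF assms(1) B C]]) auto
  then obtain \<beta> where \<beta>: "\<beta> \<in> {0..1}" and min: "\<And>\<alpha>. \<alpha> \<in> {0..1} \<Longrightarrow> ?N \<beta> \<le> ?N \<alpha>"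
    using continuous_attains_inf[of "{0..1::real}" ?N] by auto
  \<comment> \<open>Both weights lie between 0 and 1, so B + C is a crude bound; it makes the
    supremum in \<open>?N \<beta>\<close> finite.\<close>
  have bound: "A_norm A (?S \<beta> x) \<le> B + C" if "A_norm A x = 1" for x
  proof -
    have "0 \<le> snorm (X (T x))" "0 \<le> snorm (T (X x))"
      by (simp_all add: snorm_nonneg)
    then have "\<beta> * snorm (X (T x)) \<le> snorm (X (T x))"
      "(1 - \<beta>) * snorm (T (X x)) \<le> snorm (T (X x))"
      using \<beta> by (auto intro!: mult_left_le_one_le)
    then show ?thesis
      using snorm_triangle[of "\<beta> *\<^sub>R X (T x)" "(1 - \<beta>) *\<^sub>R T (X x)"] B[OF that] C[OF that] \<beta>
      by (simp add: snorm_scaleR A_norm)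
  qed
  have "(A_numradius A T)\<^sup>2 \<le> ?N \<beta>"
  proof (rule A_numradius_power2_le)
    show "0 \<le> ?N \<beta>"
      by (rule A_opnorm_nonneg[OF bound])
    fix x
    assume x: "A_norm A x = 1"
    define c where "c = cmod (A_inner A (T x) x)"
    have "c \<le> snorm (T x)"
      using Cauchy_Schwarz[of "T x" x] x by (simp add: c_def A_norm)
    then have c1: "c\<^sup>2 \<le> (snorm (T x))\<^sup>2"
      by (rule power_mono) (simp add: c_def)
    have "c \<le> snorm (X x)"
      using Cauchy_Schwarz[of x "X x"] x by (simp add: c_def A_norm adj)
    then have c2: "c\<^sup>2 \<le> (snorm (X x))\<^sup>2"
      by (rule power_mono) (simp add: c_def)
    have "c\<^sup>2 = \<beta> * c\<^sup>2 + (1 - \<beta>) * c\<^sup>2"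
      by (simp add: algebra_simps)
    also have "\<dots> \<le> \<beta> * (snorm (T x))\<^sup>2 + (1 - \<beta>) * (snorm (X x))\<^sup>2"
      using \<beta> c1 c2 by (intro add_mono mult_left_mono) auto
    \<comment> \<open>Moving the outer operator across gives <X T x, x> = <T x, T x> and <T X x, x>
      = <X x, X x> in the semi-inner product.\<close>
    also have "\<dots> = Re (A_inner A (?S \<beta> x) x)"
    proof -
      have "A_inner A (?S \<beta> x) x =
          of_real \<beta> * A_inner A (T x) (T x) + of_real (1 - \<beta>) * A_inner A (X x) (X x)"
        by (simp only: add_left scaleR_left adj adj')
      also have "\<dots> = of_real (\<beta> * (snorm (T x))\<^sup>2 + (1 - \<beta>) * (snorm (X x))\<^sup>2)"
        by (simp only: self_eq_snorm of_real_add of_real_mult)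
      finally show ?thesis
        by (simp only: Re_complex_of_real)
    qed
    also have "\<dots> \<le> A_norm A (?S \<beta> x)"
      using Cauchy_Schwarz[of "?S \<beta> x" x] complex_Re_le_cmod[of "A_inner A (?S \<beta> x) x"] x
      by (simp add: A_norm)
    also have "\<dots> \<le> ?N \<beta>"
      by (rule A_norm_le_A_opnorm[OF bound x])
    finally show "(cmod (A_inner A (T x) x))\<^sup>2 \<le> ?N \<beta>"
      by (simp add: c_def)
  qed
  moreover have "is_arg_min ?N (\<lambda>\<alpha>. 0 \<le> \<alpha> \<and> \<alpha> \<le> 1) \<beta>"
    using \<beta> min by (auto simp: is_arg_min_linorder)
  ultimately show ?thesis
    unfolding Let_def X_def[symmetric] by blast
qed

end
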